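(* Let $M,N\ge 1$ be integers, let $\mathcal{N}_m\subseteq\{0,1,\dots,N-1\}$ for $m=0,\dots,M-1$, and let $\Delta f>0$, $A>0$, $N_0>0$ be known. Suppose the observations are $$Y_m[i]=A\,e^{-j(2\pi i\Delta f\tau-\phi)}+W_m[i],\qquad m=0,\dots,M-1,\ i\in\mathcal{N}_m,$$ where $\tau$ is an unknown real delay, $\phi$ is a random phase uniformly distributed on $[0,2\pi)$, and the $W_m[i]$ are independent circularly symmetric complex Gaussian noise samples with variance $N_0/2$ per real dimension, independent of $\phi$. Then the (non-coherent) maximum likelihood estimate of $\tau$ is given by $$\hat\tau=\underset{\tau}{\arg\max}\left|\sum_{m=0}^{M-1}\sum_{i\in\mathcal{N}_m}Y_m[i]\,e^{j2\pi i\Delta f\tau}\right| .$$ Equivalently, setting $\tilde Y_m[i]=Y_m[i]$ for $i\in\mathcal{N}_m$ and $\tilde Y_m[i]=0$ for $i\in\{0,\dots,N-1\}\setminus\mathcal{N}_m$ (zero-filling the unused resources), the maximum likelihood estimate is the maximizer of the periodogram of the zero-filled data, $$\hat\tau=\underset{\tau}{\arg\max}\left|\sum_{m=0}^{M-1}\sum_{i=0}^{N-1}\tilde Y_m[i]\,e^{j2\pi i\Delta f\tau}\right| .$$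
   Context: Here $j=\sqrt{-1}$. The model is a single-target OFDM sensing model: $\Delta f$ is the subcarrier spacing, $m$ indexes OFDM symbols, $i$ indexes subcarriers, and $\mathcal{N}_m$ is the set of subcarriers used for sensing in the $m$th symbol; Doppler is not included. Conditionally on $\phi$, the joint density of the observations is $$p(Y\mid\tau,\phi)=\prod_{m}\prod_{i\in\mathcal{N}_m}\frac{1}{\pi N_0}\exp\Big(-\frac{|Y_m[i]-Ae^{-j(2\pi i\Delta f\tau-\phi)}|^2}{N_0}\Big).$$ The non-coherent maximum likelihood estimate of $\tau$ is a maximizer over $\tau$ (in the given search set of delays) of the likelihood averaged over the phase, $\frac{1}{2\pi}\int_0^{2\pi}p(Y\mid\tau,\phi)\,d\phi$; an identity $\hat\tau=\arg\max$ is understood as equality of the sets of maximizers. *)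

theory Defs
  imports "HOL-Probability.Probability"
begin

definition argmax_set :: "('a \<Rightarrow> real) \<Rightarrow> 'a set \<Rightarrow> 'a set" where
  "argmax_set f T = {t. is_arg_max f (\<lambda>t. t \<in> T) t}"

text \<open>The parameter \<open>v\<close> is the variance per real dimension.\<close>

definition circular_complex_gaussian :: "'a measure \<Rightarrow> ('a \<Rightarrow> complex) \<Rightarrow> real \<Rightarrow> bool" where
  "circular_complex_gaussian P X v \<longleftrightarrow>
     distributed P lborel (\<lambda>\<omega>. Re (X \<omega>)) (normal_density 0 (sqrt v)) \<and>
     distributed P lborel (\<lambda>\<omega>. Im (X \<omega>)) (normal_density 0 (sqrt v)) \<and>
     prob_space.indep_var P borel (\<lambda>\<omega>. Re (X \<omega>)) borel (\<lambda>\<omega>. Im (X \<omega>))"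

definition resources :: "nat \<Rightarrow> (nat \<Rightarrow> nat set) \<Rightarrow> (nat \<times> nat) set" where
  "resources M \<N> = (SIGMA m:{..<M}. \<N> m)"

definition signal :: "real \<Rightarrow> real \<Rightarrow> nat \<Rightarrow> real \<Rightarrow> real \<Rightarrow> complex" where
  "signal A \<Delta>f i \<tau> \<phi> =
     of_real A * exp (- \<i> * of_real (2 * pi * real i * \<Delta>f * \<tau> - \<phi>))"

text \<open>The joint density of the observations given the phase, with respect to Lebesgue measure
  on the complex coordinates indexed by \<open>resources M \<N>\<close>; only these entries of \<open>y\<close> matter.\<close>

definition conditional_likelihood ::
  "real \<Rightarrow> real \<Rightarrow> real \<Rightarrow> nat \<Rightarrow> (nat \<Rightarrow> nat set) \<Rightarrow> (nat \<Rightarrow> nat \<Rightarrow> complex) \<Rightarrow> real \<Rightarrow> real \<Rightarrow> real"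
  where
  "conditional_likelihood A N\<^sub>0 \<Delta>f M \<N> y \<tau> \<phi> =
     (\<Prod>m<M. \<Prod>i\<in>\<N> m. 1 / (pi * N\<^sub>0) * exp (- (norm (y m i - signal A \<Delta>f i \<tau> \<phi>))\<^sup>2 / N\<^sub>0))"

definition averaged_likelihood ::
  "real \<Rightarrow> real \<Rightarrow> real \<Rightarrow> nat \<Rightarrow> (nat \<Rightarrow> nat set) \<Rightarrow> (nat \<Rightarrow> nat \<Rightarrow> complex) \<Rightarrow> real \<Rightarrow> real"
  where
  "averaged_likelihood A N\<^sub>0 \<Delta>f M \<N> y \<tau> =
     1 / (2 * pi) * integral {0..2 * pi} (\<lambda>\<phi>. conditional_likelihood A N\<^sub>0 \<Delta>f M \<N> y \<tau> \<phi>)"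

definition noncoherent_ML_estimates ::
  "real \<Rightarrow> real \<Rightarrow> real \<Rightarrow> nat \<Rightarrow> (nat \<Rightarrow> nat set) \<Rightarrow> real set \<Rightarrow> (nat \<Rightarrow> nat \<Rightarrow> complex) \<Rightarrow> real set"
  where
  "noncoherent_ML_estimates A N\<^sub>0 \<Delta>f M \<N> T y =
     argmax_set (averaged_likelihood A N\<^sub>0 \<Delta>f M \<N> y) T"

definition zero_fill :: "(nat \<Rightarrow> nat set) \<Rightarrow> (nat \<Rightarrow> nat \<Rightarrow> complex) \<Rightarrow> nat \<Rightarrow> nat \<Rightarrow> complex" where
  "zero_fill \<N> y m i = (if i \<in> \<N> m then y m i else 0)"

end

theory Submission
  imports Defs
begin

text \<open>Expanding the squares, the likelihood given the phase is a positive factor independent of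
  the delay and the phase, times \<open>exp (Re (z * exp (- \<i> * \<phi>)))\<close>, where \<open>z\<close> is a positive multiple
  of the correlation sum. Averaging over the phase gives the Bessel function \<open>2 * pi * I\<^sub>0 (norm z)\<close>,
  which increases strictly with \<open>norm z\<close>: pairing opposite phases turns the exponential into
  a hyperbolic cosine.\<close>

text \<open>\<open>is_arg_max\<close> consults its objective only through strict comparisons between
  points of \<open>T\<close>, so an order-equivalent objective gives the same set, even when no
  maximizer exists.\<close>

lemma argmax_set_cong_less:
  assumes "\<And>s t. s \<in> T \<Longrightarrow> t \<in> T \<Longrightarrow> f s < f t \<longleftrightarrow> g s < g t"
  shows "argmax_set f T = argmax_set g T"
  using assms by (auto simp: argmax_set_def is_arg_max_def)

text \<open>Cut the shifted window from \<open>c\<close> to \<open>p + c\<close> at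
  \<open>p\<close>; periodicity moves the overhang back onto the missing initial piece from
  \<open>0\<close> to \<open>c\<close>.\<close>

lemma integral_periodic_shift:
  fixes f :: "real \<Rightarrow> real"
  assumes cont: "continuous_on UNIV f" and per: "\<And>x. f (x + p) = f x" and c: "0 \<le> c" "c \<le> p"
  shows "integral {0..p} (\<lambda>x. f (x + c)) = integral {0..p} f"
proof -
  have int: "f integrable_on {a..b}" for a b
    using cont by (intro integrable_continuous_real) (auto intro: continuous_on_subset)
  have "integral {0..p} (\<lambda>x. f (x + c)) = integral {c..p + c} f"
    using integral_shift_real_ivl[of c c "p + c" f] by simp
  also have "\<dots> = integral {c..p} f + integral {p..p + c} f"
    using c by (intro Henstock_Kurzweil_Integration.integral_combine[symmetric] int) auto
  also have "integral {p..p + c} f = integral {0..c} f"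
    using integral_shift_real_ivl[of p p "p + c" f] by (simp add: per)
  also have "integral {c..p} f + integral {0..c} f = integral {0..p} f"
    using Henstock_Kurzweil_Integration.integral_combine[of 0 c p f] c int by simp
  finally show ?thesis .
qed

lemma integral_exp_Re_rotate:
  "integral {0..2 * pi} (\<lambda>\<phi>. exp (Re (z * exp (- \<i> * of_real \<phi>)))) =
   integral {0..2 * pi} (\<lambda>\<phi>. exp (norm z * cos \<phi>))"
proof -
  \<comment> \<open>The conjugate gives \<open>z\<close> the phase \<open>- c\<close>, which merges
    with \<open>- \<phi>\<close> into a forward shift of \<open>\<phi>\<close> by \<open>c\<close>;
    \<open>Arg2pi\<close> keeps this shift within one period.\<close>
  define c where "c = Arg2pi (cnj z)"
  have c: "0 \<le> c" "c \<le> 2 * pi"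
    using Arg2pi_ge_0[of "cnj z"] Arg2pi_lt_2pi[of "cnj z"] by (auto simp: c_def)
  have "cnj z = of_real (norm z) * exp (\<i> * of_real c)"
    using Arg2pi_eq[of "cnj z"] by (simp add: c_def)
  then have "z = of_real (norm z) * exp (- \<i> * of_real c)"
    by (metis complex_cnj_cnj complex_cnj_complex_of_real complex_cnj_i complex_cnj_mult exp_cnj)
  moreover have "exp (- \<i> * of_real c) * exp (- \<i> * of_real \<phi>) = exp (- \<i> * of_real (\<phi> + c))" for \<phi>
    by (simp add: exp_add[symmetric] algebra_simps)
  ultimately have "z * exp (- \<i> * of_real \<phi>) = of_real (norm z) * exp (- \<i> * of_real (\<phi> + c))" for \<phi>
    by (metis mult.assoc)
  then have "Re (z * exp (- \<i> * of_real \<phi>)) = norm z * cos (\<phi> + c)" for \<phi>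
    by (simp add: Re_exp cos_add cos_diff)
  then show ?thesis
    using integral_periodic_shift[of "\<lambda>\<phi>. exp (norm z * cos \<phi>)" "2 * pi" c] c
    by (simp add: continuous_intros)
qed

text \<open>For fixed \<open>\<phi>\<close>, \<open>exp (r * cos \<phi>)\<close> decreases in
  \<open>r\<close> where the cosine is negative. Its symmetrization
  \<open>cosh (r * cos \<phi>)\<close> is nondecreasing in \<open>r \<ge> 0\<close> at every phase,
  so integrands can be compared pointwise.\<close>

lemma integral_exp_cos_eq_cosh:
  "integral {0..2 * pi} (\<lambda>\<phi>. exp (r * cos \<phi>)) = integral {0..2 * pi} (\<lambda>\<phi>. cosh (r * cos \<phi>))"
proof -
  have int: "(\<lambda>\<phi>. exp (s * cos \<phi>)) integrable_on {0..2 * pi}" for s :: real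
    by (intro integrable_continuous_real continuous_intros)
  \<comment> \<open>A shift by half a period flips the sign of the cosine.\<close>
  have "integral {0..2 * pi} (\<lambda>\<phi>. exp (- r * cos \<phi>)) = integral {0..2 * pi} (\<lambda>\<phi>. exp (r * cos \<phi>))"
    using integral_periodic_shift[of "\<lambda>\<phi>. exp (r * cos \<phi>)" "2 * pi" pi] by (simp add: continuous_intros)
  moreover have "integral {0..2 * pi} (\<lambda>\<phi>. cosh (r * cos \<phi>)) =
      (integral {0..2 * pi} (\<lambda>\<phi>. exp (r * cos \<phi>)) + integral {0..2 * pi} (\<lambda>\<phi>. exp (- r * cos \<phi>))) / 2"
    using int[of r] int[of "- r"]
    by (simp add: cosh_field_def Henstock_Kurzweil_Integration.integral_add)
  ultimately show ?thesis by simp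
qed

lemma integral_exp_cos_strict_mono:
  assumes "0 \<le> r" "r < s"
  shows "integral {0..2 * pi} (\<lambda>\<phi>. exp (r * cos \<phi>)) < integral {0..2 * pi} (\<lambda>\<phi>. exp (s * cos \<phi>))"
proof -
  let ?h = "\<lambda>\<phi>. cosh (s * cos \<phi>) - cosh (r * cos \<phi>)"
  have cont: "continuous_on {0..2 * pi} (\<lambda>\<phi>. cosh (u * cos \<phi>))" for u :: real
    by (intro continuous_intros)
  \<comment> \<open>Evenness of \<open>cosh\<close> makes its argument nonnegative, where
    \<open>cosh\<close> is increasing.\<close>
  have abs: "cosh (u * cos \<phi>) = cosh (u * \<bar>cos \<phi>\<bar>)" if "0 \<le> u" for u \<phi> :: real
    using that by (subst cosh_real_abs[symmetric]) (simp add: abs_mult)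
  have nonneg: "0 \<le> ?h \<phi>" for \<phi>
    using assms by (simp add: abs cosh_real_nonneg_le_iff mult_right_mono)
  have "cosh r < cosh s"
    using assms by (simp add: cosh_real_nonneg_less_iff)
  \<comment> \<open>The witness is \<open>\<phi> = 0\<close>, where the cosine is 1. A continuous
    nonnegative function that is not identically zero on the interval has nonzero integral.\<close>
  then have "\<not> (\<forall>\<phi>\<in>{0..2 * pi}. ?h \<phi> = 0)"
    by (metis atLeastAtMost_iff cos_zero diff_gt_0_iff_gt less_irrefl mult.right_neutral order_refl
        pi_ge_zero mult_nonneg_nonneg zero_le_numeral)
  then have "integral {0..2 * pi} ?h \<noteq> 0"
    using integral_eq_0_iff[of 0 "2 * pi" ?h, OF continuous_on_diff[OF cont cont] _ nonneg] by simp
  moreover have "0 \<le> integral {0..2 * pi} ?h"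
    using nonneg cont
    by (intro Henstock_Kurzweil_Integration.integral_nonneg integrable_continuous_real
        continuous_on_diff) auto
  ultimately show ?thesis
    using cont[THEN integrable_continuous_real]
    by (simp add: integral_exp_cos_eq_cosh Henstock_Kurzweil_Integration.integral_diff)
qed

text \<open>Both integrals depend only on the norms; trichotomy upgrades strict monotonicity to an
  equivalence.\<close>

lemma integral_exp_Re_less_iff:
  "integral {0..2 * pi} (\<lambda>\<phi>. exp (Re (z * exp (- \<i> * of_real \<phi>)))) <
   integral {0..2 * pi} (\<lambda>\<phi>. exp (Re (w * exp (- \<i> * of_real \<phi>)))) \<longleftrightarrow> norm z < norm w"
  unfolding integral_exp_Re_rotate
  using integral_exp_cos_strict_mono[of "norm z" "norm w"]
    integral_exp_cos_strict_mono[of "norm w" "norm z"]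
  by (cases "norm z" "norm w" rule: linorder_cases) auto

text \<open>The signal has constant modulus, so delay and phase enter only through the cross term,
  which is the correlation of \<open>y\<close> with the signal.\<close>

lemma norm_diff_signal_squared:
  "(norm (y - signal A \<Delta>f i \<tau> \<phi>))\<^sup>2 = (norm y)\<^sup>2 + A\<^sup>2
     - 2 * A * Re (y * exp (\<i> * of_real (2 * pi * real i * \<Delta>f * \<tau>)) * exp (- \<i> * of_real \<phi>))"
proof -
  define \<theta> where "\<theta> = 2 * pi * real i * \<Delta>f * \<tau> - \<phi>"
  have s: "signal A \<Delta>f i \<tau> \<phi> = of_real A * cis (- \<theta>)"
    unfolding signal_def cis_conv_exp \<theta>_def[symmetric] by simp
  have e: "exp (\<i> * of_real (2 * pi * real i * \<Delta>f * \<tau>)) * exp (- \<i> * of_real \<phi>) = cis \<theta>"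
    by (simp add: cis_conv_exp \<theta>_def exp_add[symmetric] right_diff_distrib)
  \<comment> \<open>Keeping the sum of squares unevaluated makes this a polynomial identity in the
    sine and cosine of \<open>\<theta>\<close>.\<close>
  have "(norm (y - of_real A * cis (- \<theta>)))\<^sup>2 =
      (norm y)\<^sup>2 + A\<^sup>2 * ((cos \<theta>)\<^sup>2 + (sin \<theta>)\<^sup>2) - 2 * A * Re (y * cis \<theta>)"
    unfolding cmod_power2
    by (simp add: power2_eq_square algebra_simps del: sin_cos_squared_add sin_cos_squared_add2 sin_cos_squared_add3)
  then show ?thesis
    unfolding s mult.assoc[of y] e by simp
qed

text \<open>The product of exponentials is the exponential of a sum, and linearity of
  \<open>Re\<close> pulls the common phase factor out of it. The scale
  \<open>2 * A / N\<^sub>0\<close> is the coefficient of the cross term divided by the noise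
  level.\<close>

lemma conditional_likelihood_eq:
  assumes "N\<^sub>0 > 0" and fin: "\<And>m. m < M \<Longrightarrow> finite (\<N> m)"
  shows "conditional_likelihood A N\<^sub>0 \<Delta>f M \<N> y \<tau> \<phi> =
    (\<Prod>m<M. \<Prod>i\<in>\<N> m. 1 / (pi * N\<^sub>0) * exp (- ((norm (y m i))\<^sup>2 + A\<^sup>2) / N\<^sub>0)) *
    exp (Re (of_real (2 * A / N\<^sub>0) *
      (\<Sum>m<M. \<Sum>i\<in>\<N> m. y m i * exp (\<i> * of_real (2 * pi * real i * \<Delta>f * \<tau>))) *
      exp (- \<i> * of_real \<phi>)))"
proof -
  define K where "K m i = 1 / (pi * N\<^sub>0) * exp (- ((norm (y m i))\<^sup>2 + A\<^sup>2) / N\<^sub>0)" for m i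
  define u where "u m i = y m i * exp (\<i> * of_real (2 * pi * real i * \<Delta>f * \<tau>))" for m i
  define v where "v m i = 2 * A / N\<^sub>0 * Re (u m i * exp (- \<i> * of_real \<phi>))" for m i
  have factor: "1 / (pi * N\<^sub>0) * exp (- (norm (y m i - signal A \<Delta>f i \<tau> \<phi>))\<^sup>2 / N\<^sub>0) =
      K m i * exp (v m i)" for m i
  proof -
    have "- (norm (y m i - signal A \<Delta>f i \<tau> \<phi>))\<^sup>2 / N\<^sub>0 =
        - ((norm (y m i))\<^sup>2 + A\<^sup>2) / N\<^sub>0 + v m i"
      using \<open>N\<^sub>0 > 0\<close> unfolding norm_diff_signal_squared v_def u_def by (simp add: divide_simps)
    then show ?thesis
      by (simp add: K_def exp_add)
  qed
  have Re_of_real_mult: "Re (of_real a * w) = a * Re w" for a w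
    by simp
  have "(\<Sum>m<M. \<Sum>i\<in>\<N> m. v m i) =
      2 * A / N\<^sub>0 * Re ((\<Sum>m<M. \<Sum>i\<in>\<N> m. u m i) * exp (- \<i> * of_real \<phi>))"
    unfolding v_def sum_distrib_left[symmetric] sum_distrib_right Re_sum ..
  also have "\<dots> = Re (of_real (2 * A / N\<^sub>0) * (\<Sum>m<M. \<Sum>i\<in>\<N> m. u m i) * exp (- \<i> * of_real \<phi>))"
    unfolding mult.assoc[of "of_real _"] Re_of_real_mult ..
  finally have "(\<Prod>m<M. \<Prod>i\<in>\<N> m. exp (v m i)) =
      exp (Re (of_real (2 * A / N\<^sub>0) * (\<Sum>m<M. \<Sum>i\<in>\<N> m. u m i) * exp (- \<i> * of_real \<phi>)))"
    using fin by (simp add: exp_sum[symmetric])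
  then show ?thesis
    unfolding conditional_likelihood_def factor prod.distrib K_def[symmetric] u_def[symmetric] by simp
qed

text \<open>For fixed data, \<open>K\<close> is the same positive constant at both delays and
  cancels from the comparison, as does the positive scale \<open>a\<close> inside the norms.\<close>

lemma averaged_likelihood_less_iff:
  fixes y :: "nat \<Rightarrow> nat \<Rightarrow> complex" and \<Delta>f :: real
  assumes "A > 0" "N\<^sub>0 > 0" and fin: "\<And>m. m < M \<Longrightarrow> finite (\<N> m)"
  defines "S \<equiv> \<lambda>t. \<Sum>m<M. \<Sum>i\<in>\<N> m. y m i * exp (\<i> * of_real (2 * pi * real i * \<Delta>f * t))"
  shows "averaged_likelihood A N\<^sub>0 \<Delta>f M \<N> y s < averaged_likelihood A N\<^sub>0 \<Delta>f M \<N> y t \<longleftrightarrow>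
    norm (S s) < norm (S t)"
proof -
  define K where "K = (\<Prod>m<M. \<Prod>i\<in>\<N> m. 1 / (pi * N\<^sub>0) * exp (- ((norm (y m i))\<^sup>2 + A\<^sup>2) / N\<^sub>0))"
  define a where "a = 2 * A / N\<^sub>0"
  have "a > 0"
    using assms by (simp add: a_def)
  have "K > 0"
    unfolding K_def using \<open>N\<^sub>0 > 0\<close> by (intro prod_pos) auto
  have "conditional_likelihood A N\<^sub>0 \<Delta>f M \<N> y r =
      (\<lambda>\<phi>. K * exp (Re (of_real a * S r * exp (- \<i> * of_real \<phi>))))" for r
    unfolding K_def a_def S_def by (intro ext conditional_likelihood_eq \<open>N\<^sub>0 > 0\<close> fin)
  then have "averaged_likelihood A N\<^sub>0 \<Delta>f M \<N> y r = 1 / (2 * pi) *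
      (K * integral {0..2 * pi} (\<lambda>\<phi>. exp (Re (of_real a * S r * exp (- \<i> * of_real \<phi>)))))" for r
    by (simp only: averaged_likelihood_def Henstock_Kurzweil_Integration.integral_mult_right)
  then show ?thesis
    using \<open>K > 0\<close> \<open>a > 0\<close> integral_exp_Re_less_iff[of "of_real a * S s" "of_real a * S t"]
    by (simp add: norm_mult divide_less_cancel)
qed

lemma sum_zero_fill:
  assumes "\<N> m \<subseteq> {..<N}"
  shows "(\<Sum>i<N. zero_fill \<N> y m i * f i) = (\<Sum>i\<in>\<N> m. y m i * f i)"
  using assms by (intro sum.mono_neutral_cong_right) (auto simp: zero_fill_def)

theorem mainTheorem2:
  fixes P :: "'a measure"
    and M N :: nat
    and \<N> :: "nat \<Rightarrow> nat set"
    and \<Delta>f A N\<^sub>0 \<tau> :: real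
    and T :: "real set"
    and \<phi> :: "'a \<Rightarrow> real"
    and W Y :: "nat \<Rightarrow> nat \<Rightarrow> 'a \<Rightarrow> complex"
  assumes "M \<ge> 1" and "N \<ge> 1"
    and "\<And>m. m < M \<Longrightarrow> \<N> m \<subseteq> {..<N}"
    and "\<Delta>f > 0" and "A > 0" and "N\<^sub>0 > 0"
    and "prob_space P"
    and "\<phi> \<in> borel_measurable P"
    and "distr P borel \<phi> = uniform_measure lborel {0..<2 * pi}"
    and "\<And>m i. m < M \<Longrightarrow> i \<in> \<N> m \<Longrightarrow> circular_complex_gaussian P (W m i) (N\<^sub>0 / 2)"
    and "prob_space.indep_vars P (\<lambda>_. borel) (\<lambda>(m, i). W m i) (resources M \<N>)"
    and "prob_space.indep_set P
           (sets (vimage_algebra (space P) \<phi> borel))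
           (sets (vimage_algebra (space P) (\<lambda>\<omega>. \<lambda>(m, i)\<in>resources M \<N>. W m i \<omega>)
             (\<Pi>\<^sub>M _\<in>resources M \<N>. borel)))"
    and "\<And>m i \<omega>. m < M \<Longrightarrow> i \<in> \<N> m \<Longrightarrow> \<omega> \<in> space P \<Longrightarrow>
           Y m i \<omega> = of_real A * exp (- \<i> * of_real (2 * pi * real i * \<Delta>f * \<tau> - \<phi> \<omega>)) + W m i \<omega>"
  shows "\<forall>\<omega>\<in>space P. let y = (\<lambda>m i. Y m i \<omega>) in
     noncoherent_ML_estimates A N\<^sub>0 \<Delta>f M \<N> T y =
       argmax_set (\<lambda>t. norm (\<Sum>m<M. \<Sum>i\<in>\<N> m.
         y m i * exp (\<i> * of_real (2 * pi * real i * \<Delta>f * t)))) T \<and>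
     noncoherent_ML_estimates A N\<^sub>0 \<Delta>f M \<N> T y =
       argmax_set (\<lambda>t. norm (\<Sum>m<M. \<Sum>i<N.
         zero_fill \<N> y m i * exp (\<i> * of_real (2 * pi * real i * \<Delta>f * t)))) T"
proof -
  \<comment> \<open>This holds for each fixed data array \<open>y\<close>, hence at every sample
    point. Each \<open>\<N> m\<close> is finite as a subset of \<open>{..<N}\<close>.\<close>
  have est: "noncoherent_ML_estimates A N\<^sub>0 \<Delta>f M \<N> T y = argmax_set (\<lambda>t. norm (\<Sum>m<M. \<Sum>i\<in>\<N> m.
      y m i * exp (\<i> * of_real (2 * pi * real i * \<Delta>f * t)))) T" for y
    unfolding noncoherent_ML_estimates_def
    using assms(3,5,6) by (intro argmax_set_cong_less averaged_likelihood_less_iff)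
      (auto intro: finite_subset)
  \<comment> \<open>The two complex sums agree at every delay, so the second objective is the same
    function as the first.\<close>
  have fill: "(\<Sum>m<M. \<Sum>i<N. zero_fill \<N> y m i * exp (\<i> * of_real (2 * pi * real i * \<Delta>f * t))) =
      (\<Sum>m<M. \<Sum>i\<in>\<N> m. y m i * exp (\<i> * of_real (2 * pi * real i * \<Delta>f * t)))" for y t
    using assms(3) by (intro sum.cong refl sum_zero_fill) auto
  show ?thesis
    unfolding Let_def fill using est by simp
qed

end
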